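(* Let $0<\alpha<1$. For every integer $n\ge 3$, $$\lambda_{\alpha,n,j}=g\left(\frac{(j-1)\pi}{n}\right)\qquad (j\text{ odd},\ 1\le j\le n),$$ $$g\left(\frac{(j-1)\pi}{n}\right)<\lambda_{\alpha,n,j}<g\left(\frac{j\pi}{n}\right)\qquad (j\text{ even},\ 1\le j\le n).$$
   Context: For an integer $n\ge3$ and a real number $\alpha$, $L_{\alpha,n}$ is the real symmetric $n\times n$ matrix (laplacian of the cycle on $n$ vertices in which the edge between vertices $1$ and $n$ has weight $\alpha$ and all other edges have weight $1$) with entries: $(L_{\alpha,n})_{1,1}=(L_{\alpha,n})_{n,n}=1+\alpha$; $(L_{\alpha,n})_{k,k}=2$ for $2\le k\le n-1$; $(L_{\alpha,n})_{k,k+1}=(L_{\alpha,n})_{k+1,k}=-1$ for $1\le k\le n-1$; $(L_{\alpha,n})_{1,n}=(L_{\alpha,n})_{n,1}=-\alpha$; all other entries are $0$. Its eigenvalues, counted with multiplicity, are $\lambda_{\alpha,n,1}\le\lambda_{\alpha,n,2}\le\dots\le\lambda_{\alpha,n,n}$. The function $g$ is $g(x)=2-2\cos x=4\sin^2(x/2)$, $x\in[0,\pi]$. *)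

theory Defs
  imports
    Complex_Main
    "HOL-Library.Multiset"
    "HOL-Computational_Algebra.Polynomial"
    "Jordan_Normal_Form.Char_Poly"
begin

text \<open>Entries are given with the usual matrix indices in \<open>{1..n}\<close>; matrices of
  \<^theory>\<open>Jordan_Normal_Form.Matrix\<close> are indexed from 0, hence the shift below.\<close>

definition cycle_laplacian_entry :: "real \<Rightarrow> nat \<Rightarrow> nat \<Rightarrow> nat \<Rightarrow> real" where
  "cycle_laplacian_entry \<alpha> n j k =
     (if j = k then (if j = 1 \<or> j = n then 1 + \<alpha> else 2)
      else if k = j + 1 \<or> j = k + 1 then - 1
      else if (j = 1 \<and> k = n) \<or> (j = n \<and> k = 1) then - \<alpha>
      else 0)"

definition cycle_laplacian :: "real \<Rightarrow> nat \<Rightarrow> real mat" where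
  "cycle_laplacian \<alpha> n = mat n n (\<lambda>(j, k). cycle_laplacian_entry \<alpha> n (j + 1) (k + 1))"

text \<open>The real roots of the characteristic polynomial, each repeated according to its
  multiplicity, in nondecreasing order. For a real symmetric matrix of dimension \<open>n\<close> these are
  all its \<open>n\<close> eigenvalues, and algebraic and geometric multiplicities agree.\<close>

definition sorted_eigenvalues :: "real mat \<Rightarrow> real list" where
  "sorted_eigenvalues A = sorted_list_of_multiset (proots (char_poly A))"

definition cycle_eigenvalue :: "real \<Rightarrow> nat \<Rightarrow> nat \<Rightarrow> real" where
  "cycle_eigenvalue \<alpha> n j = sorted_eigenvalues (cycle_laplacian \<alpha> n) ! (j - 1)"

definition g :: "real \<Rightarrow> real" where
  "g x = 2 - 2 * cos x"

end

theory Submission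
  imports Defs
begin

text \<open>Put \<open>\<mu> = g \<theta>\<close>. A sequence with \<open>w i + w (i + 2) = 2 cos \<theta> w (i + 1)\<close> satisfies the
  interior eigenvector equations, and the first and last rows become two boundary conditions on
  \<open>w 0\<close> and \<open>w (n + 1)\<close>. Sequences symmetric under \<open>i \<mapsto> n + 1 - i\<close>, namely
  \<open>w i = cos ((2 i - 1) \<theta> / 2)\<close>, satisfy them whenever \<open>\<theta>\<close> is a multiple of \<open>2 \<pi> / n\<close>. Antisymmetric
  ones, \<open>w i = sin ((2 i - 1 - n) \<theta> / 2)\<close>, satisfy them iff
  \<open>sin ((n + 1) \<theta> / 2) = (1 - 2 \<alpha>) sin ((n - 1) \<theta> / 2)\<close>, and for even \<open>j\<close> the difference of the two
  sides changes sign between \<open>(j - 1) \<pi> / n\<close> and \<open>j \<pi> / n\<close>. The \<open>n\<close> eigenvalues so obtained are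
  strictly increasing in \<open>j\<close>, so they exhaust the characteristic polynomial of degree \<open>n\<close>.\<close>

text \<open>The values of \<open>\<mu>\<close> are \<open>n\<close> distinct roots of a monic
  polynomial of degree \<open>n\<close>, so by counting there are no other roots and each is
  simple.\<close>

lemma sorted_eigenvalues_eq_map:
  fixes \<mu> :: "nat \<Rightarrow> real"
  assumes A: "A \<in> carrier_mat n n"
    and ev: "\<And>j. j < n \<Longrightarrow> eigenvalue A (\<mu> j)"
    and mono: "strict_mono_on {..<n} \<mu>"
  shows "sorted_eigenvalues A = map \<mu> [0..<n]"
proof -
  let ?p = "char_poly A" and ?S = "\<mu> ` {..<n}"
  have deg: "degree ?p = n" and "monic ?p" using degree_monic_char_poly[OF A] by auto
  then have nz: "?p \<noteq> 0" by auto
  have inj: "inj_on \<mu> {..<n}" using mono by (rule strict_mono_on_imp_inj_on)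
  have "?S \<subseteq> set_mset (proots ?p)"
    using ev nz eigenvalue_root_char_poly[OF A] by auto
  then have sub: "mset_set ?S \<subseteq># proots ?p"
    by (meson finite_imageI finite_lessThan finite_set_mset mset_set_set_mset_msubset
        subset_imp_msubset_mset_set subset_mset.order_trans)
  have "size (proots ?p) \<le> size (mset_set ?S)"
    using size_proots_le[of ?p] deg inj by (simp add: card_image)
  then have "proots ?p = mset_set ?S"
    using sub by (metis mset_subset_size not_less subset_mset.nless_le)
  also have "\<dots> = mset (map \<mu> [0..<n])"
    using inj by (simp add: image_mset_mset_set atLeast0LessThan)
  finally have "sorted_eigenvalues A = sort (map \<mu> [0..<n])"
    unfolding sorted_eigenvalues_def by (simp only: sorted_list_of_multiset_mset)
  also have "\<dots> = map \<mu> [0..<n]"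
    by (rule sort_key_id_if_sorted)
      (auto simp: sorted_iff_nth_mono_less intro!: less_imp_le strict_mono_onD[OF mono])
  finally show ?thesis .
qed

lemma cycle_laplacian_carrier [simp]: "cycle_laplacian \<alpha> n \<in> carrier_mat n n"
  by (simp add: cycle_laplacian_def)

text \<open>The eigenvector is \<open>w\<close> on \<open>1, ..., n\<close>; \<open>w 0\<close> and
  \<open>w (n + 1)\<close> are ghost values. Subtracting the recurrence at either end from the true
  first or last row leaves exactly \<open>left\<close> or \<open>right\<close>.\<close>

lemma eigenvalue_cycle_laplacian:
  fixes w :: "nat \<Rightarrow> real"
  assumes n: "3 \<le> n"
    and rec: "\<And>i. w i + w (i + 2) = (2 - \<mu>) * w (i + 1)"
    and left: "w 0 = (1 - \<alpha>) * w 1 + \<alpha> * w n"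
    and right: "w (n + 1) = (1 - \<alpha>) * w n + \<alpha> * w 1"
    and nz: "w 1 \<noteq> 0"
  shows "eigenvalue (cycle_laplacian \<alpha> n) \<mu>"
proof -
  let ?v = "vec n (\<lambda>i. w (i + 1))"
  let ?f = "\<lambda>i k. cycle_laplacian_entry \<alpha> n (i + 1) (k + 1) * w (k + 1)"
  have "?v $ 0 \<noteq> 0\<^sub>v n $ 0" using n nz by simp
  then have "?v \<noteq> 0\<^sub>v n" by metis
  moreover have "cycle_laplacian \<alpha> n *\<^sub>v ?v = \<mu> \<cdot>\<^sub>v ?v"
  proof (rule eq_vecI)
    fix i assume "i < dim_vec (\<mu> \<cdot>\<^sub>v ?v)"
    then have i: "i < n" by simp
    have "(\<Sum>k<n. ?f i k) = \<mu> * w (i + 1)"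
    proof -
      consider "i = 0" | "i = n - 1" "i \<noteq> 0" | "0 < i" "i < n - 1" using i by linarith
      then show ?thesis
      proof cases
        case 1
        have "(\<Sum>k<n. ?f i k) = (\<Sum>k\<in>{0, 1, n - 1}. ?f i k)"
          using n 1 by (intro sum.mono_neutral_right) (auto simp: cycle_laplacian_entry_def)
        also have "\<dots> = (1 + \<alpha>) * w 1 - w 2 - \<alpha> * w n"
          using n 1 by (simp add: cycle_laplacian_entry_def numeral_2_eq_2)
        also have "\<dots> = \<mu> * w (i + 1)"
          using 1 rec[of 0] left by (simp add: algebra_simps numeral_2_eq_2)
        finally show ?thesis .
      next
        case 2
        \<comment> \<open>Writing \<open>n\<close> as \<open>m + 3\<close> removes the truncated
          subtractions \<open>n - 1\<close> and \<open>n - 2\<close>.\<close>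
        obtain m where m: "n = m + 3" using n by (metis le_add_diff_inverse2)
        have "(\<Sum>k<n. ?f i k) = (\<Sum>k\<in>{0, n - 2, n - 1}. ?f i k)"
          using n 2 by (intro sum.mono_neutral_right) (auto simp: cycle_laplacian_entry_def)
        also have "\<dots> = (1 + \<alpha>) * w n - w (n - 1) - \<alpha> * w 1"
          using 2 unfolding m by (simp add: cycle_laplacian_entry_def numeral_2_eq_2 numeral_3_eq_3)
        also have "\<dots> = \<mu> * w (i + 1)"
          using 2 rec[of "n - 1"] right unfolding m
          by (simp add: algebra_simps numeral_2_eq_2 numeral_3_eq_3)
        finally show ?thesis .
      next
        case 3
        then obtain l where l: "i = Suc l" using gr0_conv_Suc by blast
        have "(\<Sum>k<n. ?f i k) = (\<Sum>k\<in>{i - 1, i, i + 1}. ?f i k)"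
          using n 3 by (intro sum.mono_neutral_right) (auto simp: cycle_laplacian_entry_def)
        also have "\<dots> = 2 * w (i + 1) - w i - w (i + 2)"
          using 3 unfolding l by (simp add: cycle_laplacian_entry_def)
        also have "\<dots> = \<mu> * w (i + 1)"
          using rec[of i] by (simp add: algebra_simps)
        finally show ?thesis .
      qed
    qed
    then show "(cycle_laplacian \<alpha> n *\<^sub>v ?v) $ i = (\<mu> \<cdot>\<^sub>v ?v) $ i"
      using i by (simp add: cycle_laplacian_def scalar_prod_def atLeast0LessThan)
  qed (simp add: cycle_laplacian_def)
  ultimately show ?thesis
    unfolding eigenvalue_def eigenvector_def
    by (intro exI[of _ ?v]) (simp add: cycle_laplacian_def)
qed

text \<open>With half-angle \<open>h = k pi / n\<close> the cosine sequence has period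
  \<open>n\<close> in its index, so \<open>w 0\<close>, \<open>w 1\<close>, \<open>w n\<close> and
  \<open>w (n + 1)\<close> all equal \<open>cos h\<close> and the boundary conditions hold for every
  \<open>\<alpha>\<close>. The bound on \<open>k\<close> keeps \<open>cos h\<close>
  positive.\<close>

lemma eigenvalue_cycle_laplacian_symmetric:
  assumes n: "3 \<le> n" and k: "2 * k < n"
  shows "eigenvalue (cycle_laplacian \<alpha> n) (g (real (2 * k) * pi / real n))"
proof -
  define h where "h = real k * pi / real n"
  let ?w = "\<lambda>i. cos ((2 * real i - 1) * h)"
  have nh: "real n * h = real k * pi" using n by (simp add: h_def)
  have per: "cos (2 * (real n * h) + x) = cos x" for x
    unfolding nh cos_add using sin_2npi[of k] cos_2npi[of k] by (simp add: mult_ac)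
  have h: "0 \<le> h" "h < pi / 2" using n k by (auto simp: h_def field_simps)
  have "eigenvalue (cycle_laplacian \<alpha> n) (g (2 * h))"
  proof (rule eigenvalue_cycle_laplacian[where w = ?w, OF n])
    show "?w i + ?w (i + 2) = (2 - g (2 * h)) * ?w (i + 1)" for i
      by (simp add: g_def cos_plus_cos algebra_simps add_divide_distrib diff_divide_distrib)
    show "?w 1 \<noteq> 0" using cos_gt_zero_pi[of h] h by simp
    have "?w n = cos h" using per[of "- h"] by (simp add: algebra_simps)
    moreover have "?w (n + 1) = cos h" using per[of h] by (simp add: algebra_simps)
    ultimately show "?w 0 = (1 - \<alpha>) * ?w 1 + \<alpha> * ?w n"
      and "?w (n + 1) = (1 - \<alpha>) * ?w n + \<alpha> * ?w 1"
      by (simp_all add: algebra_simps)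
  qed
  then show ?thesis by (simp add: h_def mult_ac)
qed

text \<open>Antisymmetry turns both boundary conditions into the single equation
  \<open>eq\<close>.\<close>

lemma eigenvalue_cycle_laplacian_antisymmetric:
  assumes n: "3 \<le> n" and h: "0 < h" "h < pi / 2"
    and eq: "sin ((real n + 1) * h) = (1 - 2 * \<alpha>) * sin ((real n - 1) * h)"
  shows "eigenvalue (cycle_laplacian \<alpha> n) (g (2 * h))"
proof -
  let ?w = "\<lambda>i. sin ((2 * real i - 1 - real n) * h)"
  have w: "?w 0 = - sin ((real n + 1) * h)" "?w 1 = - sin ((real n - 1) * h)"
    "?w n = sin ((real n - 1) * h)" "?w (n + 1) = sin ((real n + 1) * h)"
    by (simp_all add: algebra_simps flip: sin_minus)
  show ?thesis
  proof (rule eigenvalue_cycle_laplacian[where w = ?w, OF n])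
    show "?w i + ?w (i + 2) = (2 - g (2 * h)) * ?w (i + 1)" for i
      by (simp add: g_def sin_plus_sin algebra_simps add_divide_distrib diff_divide_distrib)
    show "?w 0 = (1 - \<alpha>) * ?w 1 + \<alpha> * ?w n"
      and "?w (n + 1) = (1 - \<alpha>) * ?w n + \<alpha> * ?w 1"
      unfolding w eq by (simp_all add: algebra_simps)
    show "?w 1 \<noteq> 0"
    proof
      \<comment> \<open>By \<open>eq\<close> the ghost values would vanish too; the sum and
        difference of the two sines then force \<open>sin (n h)\<close> and \<open>cos (n h)\<close>
        both to be zero.\<close>
      assume "?w 1 = 0"
      then have 1: "sin (real n * h - h) = 0" and 2: "sin (real n * h + h) = 0"
        using eq w by (simp_all add: algebra_simps)
      have "sin h > 0" "cos h > 0" using h sin_gt_zero[of h] cos_gt_zero_pi[of h] by auto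
      moreover have "sin (real n * h) * cos h = 0" "cos (real n * h) * sin h = 0"
        using 1 2 sin_add[of "real n * h" h] sin_diff[of "real n * h" h] by linarith+
      ultimately have "sin (real n * h) = 0" "cos (real n * h) = 0" by auto
      then show False using sin_cos_squared_add[of "real n * h"] by simp
    qed
  qed
qed

lemma g_strict_mono: "0 \<le> x \<Longrightarrow> x < y \<Longrightarrow> y \<le> pi \<Longrightarrow> g x < g y"
  by (simp add: g_def cos_monotone_0_pi)

lemma ex_eigenvalue_cycle_laplacian_antisymmetric:
  assumes \<alpha>: "0 < \<alpha>" "\<alpha> < 1" and n: "3 \<le> n" and m: "0 < m" "2 * m \<le> n"
  shows "\<exists>\<mu>. eigenvalue (cycle_laplacian \<alpha> n) \<mu> \<and>
    g ((2 * real m - 1) * pi / real n) < \<mu> \<and> \<mu> < g (2 * real m * pi / real n)"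
proof -
  define F where "F h = sin ((real n + 1) * h) - (1 - 2 * \<alpha>) * sin ((real n - 1) * h)" for h
  \<comment> \<open>Half of the two endpoint angles, because a zero \<open>h\<close> of
    \<open>F\<close> yields the eigenvalue \<open>g (2 * h)\<close>.\<close>
  define a b where "a = (2 * real m - 1) * pi / (2 * real n)" and "b = real m * pi / real n"
  have "2 * real m \<le> real n" using m(2) by linarith
  then have ab: "0 < a" "a < b" "b \<le> pi / 2"
    using n m by (auto simp: a_def b_def field_simps)
  \<comment> \<open>In this form one term drops out at each endpoint: \<open>cos (n a) = 0\<close>
    and \<open>sin (n b) = 0\<close>. What remains has opposite signs, in an order set by the parity
    of \<open>m\<close>.\<close>
  have F: "F h = 2 * \<alpha> * sin (real n * h) * cos h + 2 * (1 - \<alpha>) * cos (real n * h) * sin h" for h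
    by (simp add: F_def distrib_right left_diff_distrib sin_add sin_diff algebra_simps)
  have na: "real n * a = real m * pi - pi / 2" and nb: "real n * b = real m * pi"
    using n by (auto simp: a_def b_def field_simps)
  have Fa: "F a = - 2 * \<alpha> * (- 1) ^ m * cos a"
    unfolding F na by (simp add: sin_diff cos_diff)
  have Fb: "F b = 2 * (1 - \<alpha>) * (- 1) ^ m * sin b"
    unfolding F nb by simp
  have pos: "\<alpha> * cos a > 0" "(1 - \<alpha>) * sin b > 0"
    using \<alpha> ab sin_gt_zero[of b] cos_gt_zero_pi[of a] by auto
  have cont: "continuous_on {a..b} F" unfolding F_def by (intro continuous_intros)
  have "\<exists>h. a \<le> h \<and> h \<le> b \<and> F h = 0"
  proof (cases "even m")
    case True
    then have "F a = - 2 * (\<alpha> * cos a)" "F b = 2 * ((1 - \<alpha>) * sin b)"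
      using Fa Fb by simp_all
    then have "F a \<le> 0" "0 \<le> F b" using pos by linarith+
    then show ?thesis using IVT'[of F a 0 b] ab cont by auto
  next
    case False
    then have "F a = 2 * (\<alpha> * cos a)" "F b = - 2 * ((1 - \<alpha>) * sin b)"
      using Fa Fb by (simp_all add: algebra_simps)
    then have "F b \<le> 0" "0 \<le> F a" using pos by linarith+
    then show ?thesis using IVT2'[of F b 0 a] ab cont by auto
  qed
  then obtain h where h: "a \<le> h" "h \<le> b" "F h = 0" by auto
  \<comment> \<open>Nonzero endpoint values make the bounds on \<open>h\<close> strict; this also
    gives \<open>h < pi / 2\<close> when \<open>b = pi / 2\<close>.\<close>
  have "F a \<noteq> 0" "F b \<noteq> 0" using Fa Fb pos by auto
  then have "h \<noteq> a" "h \<noteq> b" using h by auto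
  then have h': "a < h" "h < b" using h by auto
  then have "eigenvalue (cycle_laplacian \<alpha> n) (g (2 * h))"
    using h(3) ab by (intro eigenvalue_cycle_laplacian_antisymmetric n) (auto simp: F_def)
  moreover have "g (2 * a) < g (2 * h)" "g (2 * h) < g (2 * b)"
    using h' ab by (auto intro!: g_strict_mono)
  moreover have "2 * a = (2 * real m - 1) * pi / real n" "2 * b = 2 * real m * pi / real n"
    by (simp_all add: a_def b_def)
  ultimately show ?thesis by metis
qed

theorem theorem1:
  fixes \<alpha> :: real and n :: nat
  assumes "0 < \<alpha>" and "\<alpha> < 1" and "3 \<le> n"
  shows "(\<forall>j \<in> {1..n}. odd j \<longrightarrow>
            cycle_eigenvalue \<alpha> n j = g ((real j - 1) * pi / real n)) \<and>
         (\<forall>j \<in> {1..n}. even j \<longrightarrow>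
            g ((real j - 1) * pi / real n) < cycle_eigenvalue \<alpha> n j \<and>
            cycle_eigenvalue \<alpha> n j < g (real j * pi / real n))"
proof -
  let ?A = "cycle_laplacian \<alpha> n"
  \<comment> \<open>Here \<open>i = j - 1\<close>, so even \<open>i\<close> corresponds to odd
    \<open>j\<close>.\<close>
  let ?P = "\<lambda>i \<mu>. eigenvalue ?A \<mu> \<and>
    (if even i then \<mu> = g (real i * pi / real n)
     else g (real i * pi / real n) < \<mu> \<and> \<mu> < g (real (i + 1) * pi / real n))"
  have "\<exists>\<mu>. ?P i \<mu>" if "i < n" for i
  proof (cases "even i")
    case True
    then obtain k where "i = 2 * k" by (elim evenE)
    then show ?thesis
      using eigenvalue_cycle_laplacian_symmetric[OF assms(3), of k \<alpha>] that by auto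
  next
    case False
    then obtain k where "i = 2 * k + 1" by (elim oddE)
    then show ?thesis
      using ex_eigenvalue_cycle_laplacian_antisymmetric[OF assms, of "k + 1"] that
      by (auto simp: algebra_simps)
  qed
  then obtain \<mu> where \<mu>: "\<And>i. i < n \<Longrightarrow> ?P i (\<mu> i)" by metis
  have g_less: "g (real i * pi / real n) < g (real (i + 1) * pi / real n)" if "i < n" for i
  proof (rule g_strict_mono)
    have "real (i + 1) * pi \<le> real n * pi" using that by (intro mult_right_mono) auto
    then show "real (i + 1) * pi / real n \<le> pi" using that by (simp add: field_simps)
  qed (use that in \<open>auto simp: divide_strict_right_mono\<close>)
  \<comment> \<open>The grid value \<open>g ((i + 1) pi / n)\<close> separates the two: for even
    \<open>i\<close> it equals neither, for odd \<open>i\<close> it is \<open>\<mu> (Suc i)\<close>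
    itself.\<close>
  have "\<mu> i < \<mu> (Suc i)" if "Suc i < n" for i
    using \<mu>[of i] \<mu>[of "Suc i"] g_less[of i] that by (auto split: if_splits)
  then have "\<mu> i < \<mu> j" if "i < j" "j < n" for i j
    using that by (induction j) (auto simp: less_Suc_eq intro: less_trans)
  then have "strict_mono_on {..<n} \<mu>" by (intro strict_mono_onI) auto
  then have sorted: "sorted_eigenvalues ?A = map \<mu> [0..<n]"
    using \<mu> by (intro sorted_eigenvalues_eq_map) auto
  have ev: "cycle_eigenvalue \<alpha> n j = \<mu> (j - 1)" if "j \<in> {1..n}" for j
  proof -
    have "j - 1 < n" using that by auto
    then show ?thesis using sorted by (simp add: cycle_eigenvalue_def)
  qed
  have "if odd j then cycle_eigenvalue \<alpha> n j = g ((real j - 1) * pi / real n)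
    else g ((real j - 1) * pi / real n) < cycle_eigenvalue \<alpha> n j \<and>
      cycle_eigenvalue \<alpha> n j < g (real j * pi / real n)" if "j \<in> {1..n}" for j
  proof -
    have "j - 1 < n" and "Suc (j - 1) = j" using that by auto
    then obtain i where "j = Suc i" "i < n" by metis
    then show ?thesis using \<mu>[of i] ev[of j] that by (simp split: if_splits)
  qed
  then show ?thesis by metis
qed

end
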